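(* Let $\mathbb F$ be a field of characteristic $0$ and $d\ge1$ an integer. The graph parameter $\operatorname{ec}_d$, as a function on simple graphs, is not expressible as a graph homomorphism function over $\mathbb F$; that is, there is no $\mathbb F$-weighted graph $H$ such that $\operatorname{ec}_d(G)=\hom(G,H)$ for every simple graph $G$.
   Context: For a graph $G$, $\operatorname{ec}_d(G)\in\mathbb F$ is the number (times $1\in\mathbb F$) of proper edge $d$-colorings of $G$, i.e. maps $c:E(G)\to\{1,\dots,d\}$ such that any two distinct edges sharing an endpoint receive different colors. An $\mathbb F$-weighted graph $H$ is given by $q=|V(H)|\ge0$, vertex weights $\alpha_1,\dots,\alpha_q\in\mathbb F\setminus\{0\}$ and a symmetric matrix $B=(\beta_{ij})\in\mathbb F^{q\times q}$; $\hom(G,H)=\sum_{\phi:V(G)\to[q]}\prod_{u\in V(G)}\alpha_{\phi(u)}\prod_{uv\in E(G)}\beta_{\phi(u)\phi(v)}$ (empty products equal $1$). *)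

theory Defs
  imports Complex_Main "HOL-Library.FuncSet"
begin

definition simple_graph :: "'v set \<Rightarrow> 'v set set \<Rightarrow> bool" where
  "simple_graph V E \<longleftrightarrow> finite V \<and> E \<subseteq> {e. e \<subseteq> V \<and> card e = 2}"

text \<open>Colorings are extensional functions on the edge set, so that
  the set below has one element per map from edges to colors.\<close>

definition proper_edge_colorings :: "nat \<Rightarrow> 'v set set \<Rightarrow> ('v set \<Rightarrow> nat) set" where
  "proper_edge_colorings d E =
    {c \<in> E \<rightarrow>\<^sub>E {1..d}. \<forall>e\<in>E. \<forall>f\<in>E. e \<noteq> f \<and> e \<inter> f \<noteq> {} \<longrightarrow> c e \<noteq> c f}"

definition ec :: "nat \<Rightarrow> 'v set set \<Rightarrow> 'a::field_char_0" where
  "ec d E = of_nat (card (proper_edge_colorings d E))"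

text \<open>A weighted graph has vertices \<open>1, \<dots>, q\<close>; the values of the weight functions
  at other indices are irrelevant. Diagonal entries of \<open>\<beta>\<close> (loops) and zero entries
  are allowed, and so is \<open>q = 0\<close>.\<close>

definition weighted_graph :: "nat \<Rightarrow> (nat \<Rightarrow> 'a::field) \<Rightarrow> (nat \<Rightarrow> nat \<Rightarrow> 'a) \<Rightarrow> bool" where
  "weighted_graph q \<alpha> \<beta> \<longleftrightarrow>
    (\<forall>i\<in>{1..q}. \<alpha> i \<noteq> 0) \<and> (\<forall>i\<in>{1..q}. \<forall>j\<in>{1..q}. \<beta> i j = \<beta> j i)"

text \<open>The factor contributed by an unordered edge; it does not depend on the order in
  which the endpoints are listed because \<open>\<beta>\<close> is symmetric, see \<open>edge_weight_eq\<close>.\<close>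

definition edge_weight :: "(nat \<Rightarrow> nat \<Rightarrow> 'a) \<Rightarrow> ('v \<Rightarrow> nat) \<Rightarrow> 'v set \<Rightarrow> 'a" where
  "edge_weight \<beta> \<phi> e = (THE b. \<exists>u v. e = {u, v} \<and> b = \<beta> (\<phi> u) (\<phi> v))"

lemma edge_weight_eq:
  assumes "weighted_graph q \<alpha> \<beta>" and "\<phi> u \<in> {1..q}" and "\<phi> v \<in> {1..q}"
  shows "edge_weight \<beta> \<phi> {u, v} = \<beta> (\<phi> u) (\<phi> v)"
proof -
  have "\<beta> (\<phi> u) (\<phi> v) = \<beta> (\<phi> v) (\<phi> u)"
    using assms unfolding weighted_graph_def by blast
  then show ?thesis
    unfolding edge_weight_def by (intro the_equality) (auto simp: doubleton_eq_iff)
qed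

definition hom ::
  "'v set \<Rightarrow> 'v set set \<Rightarrow> nat \<Rightarrow> (nat \<Rightarrow> 'a::field) \<Rightarrow> (nat \<Rightarrow> nat \<Rightarrow> 'a) \<Rightarrow> 'a" where
  "hom V E q \<alpha> \<beta> =
    (\<Sum>\<phi>\<in>V \<rightarrow>\<^sub>E {1..q}. (\<Prod>u\<in>V. \<alpha> (\<phi> u)) * (\<Prod>e\<in>E. edge_weight \<beta> \<phi> e))"

end

(* The star with n leaves has
     hom = sum_i alpha_i x_i^n   with   x_i = sum_j alpha_j beta_ij,
   and it has no proper edge d-coloring when n > d. A sequence of power sums of this
   form, restricted to n >= 1, satisfies a linear recurrence whose lowest coefficient
   is nonzero, so if it vanishes for all large n then it already vanishes at n = 1.
   But a single edge has d proper edge d-colorings. *)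

theory Submission
  imports Defs "HOL-Computational_Algebra.Polynomial"
begin

text \<open>Vanishing propagates downwards along the recurrence given by the polynomial whose roots
  are the nonzero \<open>x i\<close>. Exponent 0 must be excluded: an index with
  \<open>x i = 0\<close> contributes \<open>a i\<close> to that sum and nothing to any later
  one.\<close>

lemma eventually_zero_power_sum_eq_zero:
  fixes a x :: "'b \<Rightarrow> 'a::idom"
  assumes "finite S"
    and large: "\<And>n. n > N \<Longrightarrow> (\<Sum>i\<in>S. a i * x i ^ n) = 0"
    and "n > 0"
  shows "(\<Sum>i\<in>S. a i * x i ^ n) = 0"
proof -
  define s where "s n = (\<Sum>i\<in>S. a i * x i ^ n)" for n
  \<comment> \<open>The indices with \<open>x i = 0\<close> are left out so that the constant
    coefficient, up to sign the product of the nonzero \<open>x i\<close>, does not vanish.\<close>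
  define P where "P = (\<Prod>i\<in>{i\<in>S. x i \<noteq> 0}. [:- x i, 1:])"
  have P0: "coeff P 0 \<noteq> 0"
    using \<open>finite S\<close> by (simp add: P_def poly_0_coeff_0[symmetric] poly_prod)
  \<comment> \<open>If \<open>x i = 0\<close>, the power \<open>x i ^ m\<close> vanishes because m >
    0; otherwise \<open>x i\<close> is a root of \<open>P\<close>.\<close>
  have root: "x i ^ m * poly P (x i) = 0" if "i \<in> S" "m > 0" for i m
    using that \<open>finite S\<close> by (auto simp: P_def poly_prod)
  have recurrence: "(\<Sum>k\<le>degree P. coeff P k * s (m + k)) = 0" if "m > 0" for m
  proof -
    have "(\<Sum>k\<le>degree P. coeff P k * s (m + k))
        = (\<Sum>k\<le>degree P. \<Sum>i\<in>S. a i * (x i ^ m * (coeff P k * x i ^ k)))"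
      by (simp add: s_def sum_distrib_left power_add mult_ac)
    also have "\<dots> = (\<Sum>i\<in>S. \<Sum>k\<le>degree P. a i * (x i ^ m * (coeff P k * x i ^ k)))"
      by (rule sum.swap)
    also have "\<dots> = (\<Sum>i\<in>S. a i * (x i ^ m * poly P (x i)))"
      by (simp add: poly_altdef sum_distrib_left)
    also have "\<dots> = 0"
      using root[OF _ that] by (intro sum.neutral ballI) (simp only: mult_zero_right)
    finally show ?thesis .
  qed
  have "s n = 0" if "n > 0" for n
    using that
  \<comment> \<open>Downward induction on n: for n \<le> N, every later index has a smaller value of
    N - n or already lies beyond N.\<close>
  proof (induction "N - n" arbitrary: n rule: less_induct)
    case less
    show ?case
    proof (cases "n > N")
      case True
      then show ?thesis using large by (simp add: s_def)
    next
      case False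
      have "s (n + k) = 0" if "k > 0" for k
      proof (cases "n + k > N")
        case True
        then show ?thesis using large by (simp add: s_def)
      next
        case False
        then show ?thesis using that by (intro less.hyps) auto
      qed
      then have "(\<Sum>k\<in>{..degree P} - {0}. coeff P k * s (n + k)) = 0"
        by (intro sum.neutral) auto
      \<comment> \<open>All other terms of the recurrence at n have vanished, so only its lowest
        term is left.\<close>
      then have "coeff P 0 * s n = 0"
        using recurrence[OF less.prems] by (subst (asm) sum.remove[of _ 0]) simp_all
      then show ?thesis using P0 by simp
    qed
  qed
  then show ?thesis
    using \<open>n > 0\<close> by (simp add: s_def)
qed

definition star_edges :: "'v \<Rightarrow> 'v set \<Rightarrow> 'v set set" where
  "star_edges c L = (\<lambda>v. {c, v}) ` L"

lemma simple_graph_star: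
  assumes "finite L" and "c \<notin> L"
  shows "simple_graph (insert c L) (star_edges c L)"
  using assms by (auto simp: simple_graph_def star_edges_def card_2_iff)

lemma inj_on_star_edge: "inj_on (\<lambda>v. {c, v}) L"
  by (auto simp: inj_on_def doubleton_eq_iff)

lemma card_star_edges: "card (star_edges c L) = card L"
  by (simp add: star_edges_def card_image inj_on_star_edge)

text \<open>Once the image i of the centre is fixed, the leaves choose their images independently,
  and each contributes the same factor.\<close>

lemma hom_star:
  assumes wg: "weighted_graph q \<alpha> \<beta>" and "finite L" and "c \<notin> L"
  shows "hom (insert c L) (star_edges c L) q \<alpha> \<beta>
    = (\<Sum>i\<in>{1..q}. \<alpha> i * (\<Sum>j\<in>{1..q}. \<alpha> j * \<beta> i j) ^ card L)"
proof -
  let ?Q = "{1..q}"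
  have weight: "(\<Prod>u\<in>insert c L. \<alpha> ((g(c := i)) u)) * (\<Prod>e\<in>star_edges c L. edge_weight \<beta> (g(c := i)) e)
      = \<alpha> i * (\<Prod>v\<in>L. \<alpha> (g v) * \<beta> i (g v))"
    if "i \<in> ?Q" "g \<in> L \<rightarrow>\<^sub>E ?Q" for i g
  proof -
    have "edge_weight \<beta> (g(c := i)) {c, v} = \<beta> i (g v)" if "v \<in> L" for v
    proof -
      have "g v \<in> ?Q" "v \<noteq> c"
        using \<open>g \<in> L \<rightarrow>\<^sub>E ?Q\<close> that \<open>c \<notin> L\<close> by auto
      then show ?thesis
        using edge_weight_eq[OF wg, of "g(c := i)" c v] \<open>i \<in> ?Q\<close> by simp
    qed
    then have "(\<Prod>e\<in>star_edges c L. edge_weight \<beta> (g(c := i)) e) = (\<Prod>v\<in>L. \<beta> i (g v))"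
      by (simp add: star_edges_def prod.reindex inj_on_star_edge)
    moreover have "(\<Prod>v\<in>L. \<alpha> ((g(c := i)) v)) = (\<Prod>v\<in>L. \<alpha> (g v))"
      using \<open>c \<notin> L\<close> by (intro prod.cong) auto
    ultimately show ?thesis
      using \<open>finite L\<close> \<open>c \<notin> L\<close> by (simp add: prod.distrib mult_ac del: fun_upd_apply) simp
  qed
  \<comment> \<open>Since \<open>c\<close> is not a leaf, each map on the star is
    \<open>g(c := i)\<close> for exactly one pair of an image i and a map g on the leaves.\<close>
  have "hom (insert c L) (star_edges c L) q \<alpha> \<beta>
      = (\<Sum>(i, g)\<in>?Q \<times> (L \<rightarrow>\<^sub>E ?Q). (\<Prod>u\<in>insert c L. \<alpha> ((g(c := i)) u))
          * (\<Prod>e\<in>star_edges c L. edge_weight \<beta> (g(c := i)) e))"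
    unfolding hom_def PiE_insert_eq
    by (subst sum.reindex[OF inj_combinator[OF \<open>c \<notin> L\<close>]])
       (simp add: comp_def case_prod_unfold)
  also have "\<dots> = (\<Sum>(i, g)\<in>?Q \<times> (L \<rightarrow>\<^sub>E ?Q). \<alpha> i * (\<Prod>v\<in>L. \<alpha> (g v) * \<beta> i (g v)))"
    using weight by (intro sum.cong) auto
  \<comment> \<open>Distributivity: summing a product over all g is the same as multiplying the sums
    at the individual leaves.\<close>
  also have "\<dots> = (\<Sum>i\<in>?Q. \<alpha> i * (\<Prod>v\<in>L. \<Sum>j\<in>?Q. \<alpha> j * \<beta> i j))"
    using \<open>finite L\<close>
    by (subst prod_sum_PiE) (simp_all add: sum.cartesian_product[symmetric] sum_distrib_left)
  finally show ?thesis
    by simp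
qed

text \<open>Any two edges of a star meet in the centre, so a proper coloring is injective, which
  more than d edges do not allow.\<close>

lemma proper_edge_colorings_star_empty:
  assumes "finite L" and "d < card L"
  shows "proper_edge_colorings d (star_edges c L) = {}"
proof (rule ccontr)
  assume "proper_edge_colorings d (star_edges c L) \<noteq> {}"
  then obtain f where "f \<in> proper_edge_colorings d (star_edges c L)"
    by blast
  then have f: "f \<in> star_edges c L \<rightarrow>\<^sub>E {1..d}"
    and proper: "\<forall>e\<in>star_edges c L. \<forall>e'\<in>star_edges c L. e \<noteq> e' \<and> e \<inter> e' \<noteq> {} \<longrightarrow> f e \<noteq> f e'"
    by (simp_all add: proper_edge_colorings_def)
  have "e \<inter> e' \<noteq> {}" if "e \<in> star_edges c L" "e' \<in> star_edges c L" for e e'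
    using that by (auto simp: star_edges_def)
  then have "inj_on f (star_edges c L)"
    using proper by (meson inj_onI)
  then have "card (star_edges c L) \<le> card {1..d}"
    using f by (intro card_inj_on_le) auto
  then show False
    using assms by (simp add: card_star_edges)
qed

lemma card_proper_edge_colorings_singleton: "card (proper_edge_colorings d {e}) = d"
proof -
  have "proper_edge_colorings d {e} = {e} \<rightarrow>\<^sub>E {1..d}"
    by (auto simp: proper_edge_colorings_def)
  then show ?thesis
    by (simp add: card_PiE)
qed

theorem theorem4p6:
  fixes d :: nat
  assumes "d \<ge> 1"
  shows "\<not> (\<exists>(q::nat) (\<alpha>::nat \<Rightarrow> 'a::field_char_0) (\<beta>::nat \<Rightarrow> nat \<Rightarrow> 'a).
           weighted_graph q \<alpha> \<beta> \<and>
           (\<forall>(V::nat set) E. simple_graph V E \<longrightarrow> ec d E = hom V E q \<alpha> \<beta>))"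
proof
  assume "\<exists>(q::nat) (\<alpha>::nat \<Rightarrow> 'a) (\<beta>::nat \<Rightarrow> nat \<Rightarrow> 'a).
           weighted_graph q \<alpha> \<beta> \<and>
           (\<forall>(V::nat set) E. simple_graph V E \<longrightarrow> ec d E = hom V E q \<alpha> \<beta>)"
  then obtain q and \<alpha> :: "nat \<Rightarrow> 'a" and \<beta> :: "nat \<Rightarrow> nat \<Rightarrow> 'a"
    where wg: "weighted_graph q \<alpha> \<beta>"
      and ec_eq_hom: "\<And>(V::nat set) E. simple_graph V E \<Longrightarrow> ec d E = hom V E q \<alpha> \<beta>"
    by blast
  \<comment> \<open>Centre 0 and leaves 1, ..., n realize the star on natural numbers, with the
    centre outside the leaf set.\<close>
  have ec_star: "ec d (star_edges (0::nat) {1..n})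
      = (\<Sum>i\<in>{1..q}. \<alpha> i * (\<Sum>j\<in>{1..q}. \<alpha> j * \<beta> i j) ^ n)" for n
    using ec_eq_hom[OF simple_graph_star[of "{1..n}" 0]] hom_star[OF wg, of "{1..n}" 0] by simp
  have "(\<Sum>i\<in>{1..q}. \<alpha> i * (\<Sum>j\<in>{1..q}. \<alpha> j * \<beta> i j) ^ n) = 0" if "n > d" for n
    using ec_star[of n] that by (simp add: ec_def proper_edge_colorings_star_empty)
  then have "(\<Sum>i\<in>{1..q}. \<alpha> i * (\<Sum>j\<in>{1..q}. \<alpha> j * \<beta> i j) ^ 1) = 0"
    by (rule eventually_zero_power_sum_eq_zero[OF finite_atLeastAtMost _ zero_less_one])
  then have "ec d (star_edges (0::nat) {1..1}) = (0::'a)"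
    using ec_star[of 1] by simp
  \<comment> \<open>The star with one leaf is a single edge, which has d colorings; characteristic 0
    and d \<ge> 1 then give the contradiction.\<close>
  then have "of_nat d = (0::'a)"
    by (simp add: ec_def star_edges_def card_proper_edge_colorings_singleton)
  then show False
    using assms by simp
qed

end
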